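(* Let $xs$ be a list of variable names, $xs_v$ a finite set of variable names, $s_v$ a VeriFast Cx statement, $q_v$ a VeriFast Cx expression, and $s_h$ a CH2O core C statement. Suppose that 1. $xs$ is a permutation of the (duplicate-free) list of elements of $xs_v$; 2. $\mathrm{stmt\_rel}\ xs\ s_v\ s_h$ holds; 3. $\mathrm{VFcorrect}(xs_v, \mathtt{ExprTrue}, s_v, q_v)$ holds, i.e. the function with arguments $xs_v$, precondition $\mathtt{ExprTrue}$, body $s_v$ and postcondition $q_v$ is correct in the VeriFast Cx big-step semantics. Then for every core C store $\sigma_h$ (a list of elements of $\mathrm{option}\ \mathbb{Z}$) all of whose entries are of the form $\mathrm{Some}\ z$, $\mathrm{CHcorrect}(\mathrm{length}(xs), s_h, \sigma_h)$ holds; that is, if $\sigma_h$ has length $\mathrm{length}(xs)$ and is well-typed (all stored integers lie in $[-2^{31},2^{31}-1]$), then either there is $z\in\mathbb{Z}$ such that $s_h$ started in $\sigma_h$ terminates with outcome $\mathrm{OReturn}\ z$ in the core C big-step semantics, or $s_h$ started in $\sigma_h$ diverges in the core C big-step semantics.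
   Context: Integer type: signed int of the LP64 model; "in range" means lying in $[-2^{31},2^{31}-1]$. Variable names are strings. $\mathtt{l\,!!\,k}$ is partial lookup (in a list, by 0-based index; in a map, by key); $\sigma[x:=z]$ is map/list update. **VeriFast Cx syntax.** Expressions: $\mathtt{ExprTrue}$, $\mathtt{ExprFalse}$, $\mathtt{ExprIntLit}\,z$ ($z\in\mathbb Z$), $\mathtt{ExprVar}\,x$, binary $\mathtt{ExprAdd,ExprSub,ExprDiv,ExprLt,ExprLe,ExprEq,ExprNeq,ExprAnd,ExprOr}$, unary $\mathtt{ExprNot}$, and $\mathtt{ExprAssign}\,e_1\,e_2$. Statements: $\mathtt{StmtSkip}$, $\mathtt{StmtSeq}\,s_1\,s_2$, $\mathtt{StmtLet}\,x\,e\,s$, $\mathtt{StmtExpr}\,e$, $\mathtt{StmtIf}\,e\,s_1\,s_2$, $\mathtt{StmtRet}\,e$, $\mathtt{StmtWhile}\,e\,i\,s$ (condition $e$, loop invariant $i$, body $s$), $\mathtt{StmtBlock}\,s$. **VeriFast Cx stores and expression evaluation.** A store $\sigma$ is a finite partial map from strings to $\mathbb Z$. $\mathrm{evalZ}(e,\sigma)\in\mathrm{option}\,\mathbb Z$: a literal $z$ gives $z$; a variable gives $\sigma\,!!\,x$; $\mathtt{ExprAdd,ExprSub,ExprDiv}$ give the sum, difference, quotient truncated towards zero of the operands' values, provided both operands evaluate, the divisor is nonzero (for division) and the result is in range; otherwise undefined; undefined on all other expressions. $\mathrm{evalB}(e,\sigma)\in\mathrm{option}\,\mathrm{bool}$: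 the constants true/false; comparisons $<,\le,=,\neq$ of operands that both evaluate under $\mathrm{evalZ}$; conjunction, disjunction, negation of operands that evaluate under $\mathrm{evalB}$; otherwise undefined. For $k:\mathrm{Prop}\to\mathrm{Prop}$, $\mathrm{translate}(e,k,\sigma)$ is the proposition $k(P)$ if the boolean expression $e$ can be evaluated in $\sigma$, with $P$ the proposition it denotes there (e.g. $\mathtt{ExprTrue}$ denotes $\top$), and is $\bot$ otherwise. **VeriFast Cx terminating execution.** Outcomes: $\mathrm{Normal}$ or $\mathrm{Return}\,z$. The relation $\sigma, s\Downarrow \sigma', out$ is inductively defined by: - $\sigma,\mathtt{StmtSkip}\Downarrow\sigma,\mathrm{Normal}$. - If $\sigma,s_1\Downarrow\sigma',\mathrm{Normal}$ and $\sigma',s_2\Downarrow\sigma'',out$ then $\sigma,\mathtt{StmtSeq}\,s_1\,s_2\Downarrow\sigma'',out$. If $\sigma,s_1\Downarrow\sigma',out$ with $out\ne\mathrm{Normal}$ then $\sigma,\mathtt{StmtSeq}\,s_1\,s_2\Downarrow\sigma',out$. - If $\sigma\,!!\,x$ is undefined, $\mathrm{evalZ}(e,\sigma)=z$ and $\sigma[x:=z],s\Downarrow\sigma',out$ then $\sigma,\mathtt{StmtLet}\,x\,e\,s\Downarrow(\sigma'\text{ with }x\text{ deleted}),out$. - If $\sigma\,!!\,x$ is defined and $\mathrm{evalZ}(e,\sigma)=z$ then $\sigma,\mathtt{StmtExpr}(\mathtt{ExprAssign}(\mathtt{ExprVar}\,x)\,e)\Downarrow\sigma[x:=z],\mathrm{Normal}$.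 - If $\mathrm{evalB}(e,\sigma)$ is true (resp. false) and $\sigma,s_1\Downarrow\sigma',out$ (resp. $\sigma,s_2\Downarrow\sigma',out$) then $\sigma,\mathtt{StmtIf}\,e\,s_1\,s_2\Downarrow\sigma',out$. - If $\mathrm{evalZ}(e,\sigma)=z$ then $\sigma,\mathtt{StmtRet}\,e\Downarrow\sigma,\mathrm{Return}\,z$. - While: if $\mathrm{evalB}(e,\sigma)=$ true, $\sigma,s\Downarrow\sigma',out$, $out\neq\mathrm{Normal}$, then $\sigma,\mathtt{StmtWhile}\,e\,i\,s\Downarrow\sigma',out$; if $\mathrm{evalB}(e,\sigma)=$ true, $\sigma,s\Downarrow\sigma',\mathrm{Normal}$ and $\sigma',\mathtt{StmtWhile}\,e\,i\,s\Downarrow\sigma'',out$, then $\sigma,\mathtt{StmtWhile}\,e\,i\,s\Downarrow\sigma'',out$; if $\mathrm{evalB}(e,\sigma)=$ false then $\sigma,\mathtt{StmtWhile}\,e\,i\,s\Downarrow\sigma,\mathrm{Normal}$. - If $\sigma,s\Downarrow\sigma',out$ then $\sigma,\mathtt{StmtBlock}\,s\Downarrow\sigma',out$. **VeriFast Cx diverging execution.** $\sigma,s\Uparrow$ is coinductively defined by: $\mathtt{StmtSeq}\,s_1\,s_2$ diverges from $\sigma$ if $\sigma,s_1\Uparrow$, or if $\sigma,s_1\Downarrow\sigma',\mathrm{Normal}$ and $\sigma',s_2\Uparrow$; $\mathtt{StmtLet}\,x\,e\,s$ if $\sigma\,!!\,x$ is undefined, $\mathrm{evalZ}(e,\sigma)=z$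 and $\sigma[x:=z],s\Uparrow$; $\mathtt{StmtIf}\,e\,s_1\,s_2$ if $\mathrm{evalB}(e,\sigma)$ is true and $\sigma,s_1\Uparrow$, or is false and $\sigma,s_2\Uparrow$; $\mathtt{StmtWhile}\,e\,i\,s$ if $\mathrm{evalB}(e,\sigma)$ is true and either $\sigma,s\Uparrow$, or $\sigma,s\Downarrow\sigma',\mathrm{Normal}$ and $\sigma',\mathtt{StmtWhile}\,e\,i\,s\Uparrow$; $\mathtt{StmtBlock}\,s$ if $\sigma,s\Uparrow$. **VeriFast Cx function correctness.** $\mathrm{VFcorrect}(X,p,s,q)$, for a finite set $X$ of names, means: for every store $\sigma$ with all values in range, undefined outside $X$, and with $X\subseteq\mathrm{dom}\,\sigma$, the proposition $\mathrm{translate}(p,k,\sigma)$ holds, where $k(P)$ is: $P$ implies [ (there exist $\sigma',v$ with $\mathrm{translate}(q,\ \lambda Q.\ (\sigma,s\Downarrow\sigma',\mathrm{Return}\,v)\wedge Q,\ \sigma[\texttt{result}:=v])$) or $\sigma,s\Uparrow$ ]. **CH2O core C.** Core C is the kernel C language of Krebbers' CH2O formalization of C11; it uses de Bruijn indices for local variables. Relevant expressions: literal $\#\,\mathrm{int}\,z$ of type signed int, $\mathrm{load}(\mathrm{var}\,i)$, unary operations $\mathrm{op}\,e$, binary operations $e_1\,\mathrm{op}\,e_2$, assignment $\mathrm{var}\,i ::= e$, casts $\mathrm{cast}_\tau e$. Relevant statements: $\mathrm{skip}$, $s_1;;s_2$, $\mathrm{local}_{\tau}\,s$ (declares an uninitialised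 local of type $\tau$, which becomes index 0), expression statement $!e$ (and $\mathrm{var}\,i::=e$ used as a statement means $!(\mathrm{var}\,i::=e)$), $\mathrm{if}\{e\}\,s_1\,\mathrm{else}\,s_2$, $\mathrm{throw}\,n$, $\mathrm{catch}\,s$, $\mathrm{loop}\,s$, $\mathrm{ret}\,e$. Write sint for signed int. **Core C big-step stores, evaluation.** A store is a list of elements of $\mathrm{option}\,\mathbb Z$ (entry $\mathrm{None}$ = uninitialised). $\mathrm{eval}\,\sigma\,e\,z$ is inductively defined: $\mathrm{eval}\,\sigma\,(\#\,\mathrm{int}\,z)\,z$ if $z$ in range; $\mathrm{eval}\,\sigma\,(\mathrm{load}(\mathrm{var}\,i))\,z$ if $\sigma\,!!\,i=\mathrm{Some}(\mathrm{Some}\,z)$; for the unary operation logical not, if $\mathrm{eval}\,\sigma\,e\,z$ then $\mathrm{eval}\,\sigma\,(\mathrm{not}\,e)\,z'$ with $z'=1$ if $z=0$ and $0$ otherwise; for binary $+,-,/,<,\le,==$, if $\mathrm{eval}\,\sigma\,e_j\,z_j$ ($j=1,2$), divisor nonzero for $/$, and the result $r$ (truncated quotient for $/$; $1$/$0$ for true/false comparisons) is in range, then $\mathrm{eval}\,\sigma\,(e_1\,\mathrm{op}\,e_2)\,r$. **Core C terminating execution.** Outcomes: $\mathrm{ONormal}\,\sigma'$, $\mathrm{OReturn}\,z$, $\mathrm{OThrow}\,n\,\sigma'$. "Abnormal" = not of the form $\mathrm{ONormal}$; "nothrown" = not of the form $\mathrm{OThrow}$. $\mathrm{exec}\,\sigma\,s\,O$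 is inductively defined by: - $\mathrm{exec}\,\sigma\,\mathrm{skip}\,(\mathrm{ONormal}\,\sigma)$. - $\mathrm{exec}\,\sigma\,(s_1;;s_2)\,O$ if $\mathrm{exec}\,\sigma\,s_1\,(\mathrm{ONormal}\,\sigma')$ and $\mathrm{exec}\,\sigma'\,s_2\,O$; or if $O$ is abnormal and $\mathrm{exec}\,\sigma\,s_1\,O$. - If $\mathrm{exec}\,(\mathrm{None}::\sigma)\,s\,O'$ then $\mathrm{exec}\,\sigma\,(\mathrm{local}_{\mathrm{sint}}\,s)\,O$, where $(O',O)$ is one of $(\mathrm{ONormal}(mv::\sigma'),\mathrm{ONormal}\,\sigma')$, $(\mathrm{OReturn}\,z,\mathrm{OReturn}\,z)$, $(\mathrm{OThrow}\,n\,(mv::\sigma'),\mathrm{OThrow}\,n\,\sigma')$. - If $i<\mathrm{length}\,\sigma$ and $\mathrm{eval}\,\sigma\,e\,z$ then both $\mathrm{var}\,i::=\mathrm{cast}_{\mathrm{sint}}e$ and $!(\mathrm{cast}_{\mathrm{void}}(\mathrm{var}\,i::=e))$ execute from $\sigma$ with outcome $\mathrm{ONormal}(\sigma[i:=\mathrm{Some}\,z])$. - If $\mathrm{eval}\,\sigma\,e\,z$ and $\mathrm{exec}\,\sigma\,s'\,O$ with $s'=s_2$ if $z=0$ and $s'=s_1$ otherwise, then $\mathrm{exec}\,\sigma\,(\mathrm{if}\{e\}\,s_1\,\mathrm{else}\,s_2)\,O$. - $\mathrm{exec}\,\sigma\,(\mathrm{throw}\,n)\,(\mathrm{OThrow}\,n\,\sigma)$.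 - $\mathrm{exec}\,\sigma\,(\mathrm{catch}\,s)\,(\mathrm{ONormal}\,\sigma')$ if $\mathrm{exec}\,\sigma\,s\,(\mathrm{OThrow}\,0\,\sigma')$; $\mathrm{exec}\,\sigma\,(\mathrm{catch}\,s)\,(\mathrm{OThrow}\,n\,\sigma')$ if $\mathrm{exec}\,\sigma\,s\,(\mathrm{OThrow}\,(n+1)\,\sigma')$; $\mathrm{exec}\,\sigma\,(\mathrm{catch}\,s)\,O$ if $O$ is nothrown and $\mathrm{exec}\,\sigma\,s\,O$. - For abnormal $O$: $\mathrm{exec}\,\sigma\,(\mathrm{loop}\,s)\,O$ if $\mathrm{exec}\,\sigma\,s\,O$, or if $\mathrm{exec}\,\sigma\,s\,(\mathrm{ONormal}\,\sigma')$ and $\mathrm{exec}\,\sigma'\,(\mathrm{loop}\,s)\,O$. - $\mathrm{exec}\,\sigma\,(\mathrm{ret}(\mathrm{cast}_{\mathrm{sint}}e))\,(\mathrm{OReturn}\,z)$ if $\mathrm{eval}\,\sigma\,e\,z$. **Core C diverging execution.** $\mathrm{execinf}\,\sigma\,s$ is coinductively defined by: $s_1;;s_2$ diverges from $\sigma$ if $\mathrm{execinf}\,\sigma\,s_1$, or $\mathrm{exec}\,\sigma\,s_1\,(\mathrm{ONormal}\,\sigma')$ and $\mathrm{execinf}\,\sigma'\,s_2$; $\mathrm{local}_{\mathrm{sint}}\,s$ if $\mathrm{execinf}\,(\mathrm{None}::\sigma)\,s$; $\mathrm{if}\{e\}\,s_1\,\mathrm{else}\,s_2$ if $\mathrm{eval}\,\sigma\,e\,z$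 and the selected branch ($s_2$ if $z=0$, else $s_1$) diverges from $\sigma$; $\mathrm{catch}\,s$ if $\mathrm{execinf}\,\sigma\,s$; $\mathrm{loop}\,s$ if $\mathrm{execinf}\,\sigma\,s$, or $\mathrm{exec}\,\sigma\,s\,(\mathrm{ONormal}\,\sigma')$ and $\mathrm{execinf}\,\sigma'\,(\mathrm{loop}\,s)$. **Core C big-step function correctness.** $\mathrm{CHcorrect}(n,s,\sigma)$ means: if $\mathrm{length}\,\sigma=n$ and every integer stored in $\sigma$ is in range, then $(\exists z,\ \mathrm{exec}\,\sigma\,s\,(\mathrm{OReturn}\,z))$ or $\mathrm{execinf}\,\sigma\,s$. **Relation between programs.** For a list $xs$ of declared names (position = de Bruijn index): $\mathrm{expr\_rel\_int}\,xs$ relates $\mathtt{ExprIntLit}\,z$ to $\#\,\mathrm{int}\,z$ ($z$ in range), $\mathtt{ExprVar}\,x$ to $\mathrm{load}(\mathrm{var}\,i)$ when $xs\,!!\,i=\mathrm{Some}\,x$, and $\mathtt{ExprAdd/Sub/Div}$ to $+,-,/$ of related operands; $\mathrm{expr\_rel\_bool}\,xs$ relates $\mathtt{ExprLt/Le/Eq}$ to $<,\le,==$ of operands related by $\mathrm{expr\_rel\_int}$, $\mathtt{ExprNeq}$ to $\mathrm{not}$ of $==$, and $\mathtt{ExprNot}$ to $\mathrm{not}$ of a boolean-related operand. $\mathrm{stmt\_rel}\,xs\,s_v\,s_h$ is inductively defined by: - $\mathtt{StmtSkip}\sim\mathrm{skip}$; $\mathtt{StmtSeq}\,s_1\,s_2\sim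 s_1';;s_2'$ if $s_j\sim s_j'$ (same $xs$). - $\mathtt{StmtLet}\,x\,e\,s\sim\mathrm{local}_{\mathrm{sint}}((\mathrm{var}\,0::=\mathrm{cast}_{\mathrm{sint}}e');;s')$ if $x\notin xs$, $\mathrm{expr\_rel\_int}\,(x::xs)\,e\,e'$ and $\mathrm{stmt\_rel}\,(x::xs)\,s\,s'$. - $\mathtt{StmtExpr}(\mathtt{ExprAssign}(\mathtt{ExprVar}\,x)\,e)\sim\ !(\mathrm{cast}_{\mathrm{void}}(\mathrm{var}\,i::=e'))$ if $x\in xs$, $xs\,!!\,i=\mathrm{Some}\,x$, $\mathrm{expr\_rel\_int}\,xs\,e\,e'$. - $\mathtt{StmtIf}\,e\,s_1\,s_2\sim\mathrm{if}\{e'\}\,s_1'\,\mathrm{else}\,s_2'$ if $\mathrm{expr\_rel\_bool}\,xs\,e\,e'$ and $s_j\sim s_j'$. - $\mathtt{StmtWhile}\,e\,i\,s\sim\mathrm{catch}(\mathrm{loop}((\mathrm{if}\{e'\}\,\mathrm{skip}\,\mathrm{else}\,\mathrm{throw}\,0);;\mathrm{catch}\,s'))$ if $\mathrm{expr\_rel\_bool}\,xs\,e\,e'$ and $s\sim s'$. - $\mathtt{StmtRet}\,e\sim\mathrm{ret}(\mathrm{cast}_{\mathrm{sint}}e')$ if $\mathrm{expr\_rel\_int}\,xs\,e\,e'$. *)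

theory Defs
  imports
    "HOL-Library.Finite_Map"
    "HOL-Library.Signed_Division"
    "HOL-Combinatorics.Multiset_Permutations"
begin

definition in_range :: "int \<Rightarrow> bool" where
  "in_range z \<longleftrightarrow> - (2 ^ 31) \<le> z \<and> z \<le> 2 ^ 31 - 1"

section \<open>VeriFast Cx\<close>

datatype vf_expr =
    ExprTrue
  | ExprFalse
  | ExprIntLit int
  | ExprVar string
  | ExprAdd vf_expr vf_expr
  | ExprSub vf_expr vf_expr
  | ExprDiv vf_expr vf_expr
  | ExprLt vf_expr vf_expr
  | ExprLe vf_expr vf_expr
  | ExprEq vf_expr vf_expr
  | ExprNeq vf_expr vf_expr
  | ExprAnd vf_expr vf_expr
  | ExprOr vf_expr vf_expr
  | ExprNot vf_expr
  | ExprAssign vf_expr vf_expr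

datatype vf_stmt =
    StmtSkip
  | StmtSeq vf_stmt vf_stmt
  | StmtLet string vf_expr vf_stmt
  | StmtExpr vf_expr
  | StmtIf vf_expr vf_stmt vf_stmt
  | StmtRet vf_expr
  | StmtWhile vf_expr vf_expr vf_stmt  \<comment> \<open>condition, loop invariant, body\<close>
  | StmtBlock vf_stmt

type_synonym vf_store = "(string, int) fmap"

definition check_range :: "int \<Rightarrow> int option" where
  "check_range z = (if in_range z then Some z else None)"

text \<open>
  \<open>sdiv\<close> is division truncated towards zero (\<open>div\<close> on integers rounds down).
  Literals and variables are deliberately not range-checked.
\<close>

fun evalZ :: "vf_expr \<Rightarrow> vf_store \<Rightarrow> int option" where
  "evalZ (ExprIntLit z) \<sigma> = Some z"
| "evalZ (ExprVar x) \<sigma> = fmlookup \<sigma> x"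
| "evalZ (ExprAdd e1 e2) \<sigma> =
    (case (evalZ e1 \<sigma>, evalZ e2 \<sigma>) of
      (Some z1, Some z2) \<Rightarrow> check_range (z1 + z2) | _ \<Rightarrow> None)"
| "evalZ (ExprSub e1 e2) \<sigma> =
    (case (evalZ e1 \<sigma>, evalZ e2 \<sigma>) of
      (Some z1, Some z2) \<Rightarrow> check_range (z1 - z2) | _ \<Rightarrow> None)"
| "evalZ (ExprDiv e1 e2) \<sigma> =
    (case (evalZ e1 \<sigma>, evalZ e2 \<sigma>) of
      (Some z1, Some z2) \<Rightarrow> if z2 = 0 then None else check_range (z1 sdiv z2) | _ \<Rightarrow> None)"
| "evalZ _ \<sigma> = None"

fun evalB :: "vf_expr \<Rightarrow> vf_store \<Rightarrow> bool option" where
  "evalB ExprTrue \<sigma> = Some True"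
| "evalB ExprFalse \<sigma> = Some False"
| "evalB (ExprLt e1 e2) \<sigma> =
    (case (evalZ e1 \<sigma>, evalZ e2 \<sigma>) of (Some z1, Some z2) \<Rightarrow> Some (z1 < z2) | _ \<Rightarrow> None)"
| "evalB (ExprLe e1 e2) \<sigma> =
    (case (evalZ e1 \<sigma>, evalZ e2 \<sigma>) of (Some z1, Some z2) \<Rightarrow> Some (z1 \<le> z2) | _ \<Rightarrow> None)"
| "evalB (ExprEq e1 e2) \<sigma> =
    (case (evalZ e1 \<sigma>, evalZ e2 \<sigma>) of (Some z1, Some z2) \<Rightarrow> Some (z1 = z2) | _ \<Rightarrow> None)"
| "evalB (ExprNeq e1 e2) \<sigma> =
    (case (evalZ e1 \<sigma>, evalZ e2 \<sigma>) of (Some z1, Some z2) \<Rightarrow> Some (z1 \<noteq> z2) | _ \<Rightarrow> None)"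
| "evalB (ExprAnd e1 e2) \<sigma> =
    (case (evalB e1 \<sigma>, evalB e2 \<sigma>) of (Some b1, Some b2) \<Rightarrow> Some (b1 \<and> b2) | _ \<Rightarrow> None)"
| "evalB (ExprOr e1 e2) \<sigma> =
    (case (evalB e1 \<sigma>, evalB e2 \<sigma>) of (Some b1, Some b2) \<Rightarrow> Some (b1 \<or> b2) | _ \<Rightarrow> None)"
| "evalB (ExprNot e) \<sigma> =
    (case evalB e \<sigma> of Some b \<Rightarrow> Some (\<not> b) | None \<Rightarrow> None)"
| "evalB _ \<sigma> = None"

text \<open>
  In HOL propositions are booleans, so the proposition denoted by an expression is
  its value under \<open>evalB\<close>.
\<close>

definition translate :: "vf_expr \<Rightarrow> (bool \<Rightarrow> bool) \<Rightarrow> vf_store \<Rightarrow> bool" where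
  "translate e k \<sigma> = (case evalB e \<sigma> of Some P \<Rightarrow> k P | None \<Rightarrow> False)"

datatype vf_outcome = Normal | Return int

inductive vf_exec :: "vf_store \<Rightarrow> vf_stmt \<Rightarrow> vf_store \<Rightarrow> vf_outcome \<Rightarrow> bool" where
  vf_skip: "vf_exec \<sigma> StmtSkip \<sigma> Normal"
| vf_seq: "vf_exec \<sigma> s1 \<sigma>' Normal \<Longrightarrow> vf_exec \<sigma>' s2 \<sigma>'' out \<Longrightarrow>
    vf_exec \<sigma> (StmtSeq s1 s2) \<sigma>'' out"
| vf_seq_abnormal: "vf_exec \<sigma> s1 \<sigma>' out \<Longrightarrow> out \<noteq> Normal \<Longrightarrow>
    vf_exec \<sigma> (StmtSeq s1 s2) \<sigma>' out"
| vf_let: "fmlookup \<sigma> x = None \<Longrightarrow> evalZ e \<sigma> = Some z \<Longrightarrow>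
    vf_exec (fmupd x z \<sigma>) s \<sigma>' out \<Longrightarrow>
    vf_exec \<sigma> (StmtLet x e s) (fmdrop x \<sigma>') out"
| vf_assign: "fmlookup \<sigma> x \<noteq> None \<Longrightarrow> evalZ e \<sigma> = Some z \<Longrightarrow>
    vf_exec \<sigma> (StmtExpr (ExprAssign (ExprVar x) e)) (fmupd x z \<sigma>) Normal"
| vf_if_true: "evalB e \<sigma> = Some True \<Longrightarrow> vf_exec \<sigma> s1 \<sigma>' out \<Longrightarrow>
    vf_exec \<sigma> (StmtIf e s1 s2) \<sigma>' out"
| vf_if_false: "evalB e \<sigma> = Some False \<Longrightarrow> vf_exec \<sigma> s2 \<sigma>' out \<Longrightarrow>
    vf_exec \<sigma> (StmtIf e s1 s2) \<sigma>' out"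
| vf_ret: "evalZ e \<sigma> = Some z \<Longrightarrow> vf_exec \<sigma> (StmtRet e) \<sigma> (Return z)"
| vf_while_abnormal: "evalB e \<sigma> = Some True \<Longrightarrow> vf_exec \<sigma> s \<sigma>' out \<Longrightarrow> out \<noteq> Normal \<Longrightarrow>
    vf_exec \<sigma> (StmtWhile e i s) \<sigma>' out"
| vf_while_step: "evalB e \<sigma> = Some True \<Longrightarrow> vf_exec \<sigma> s \<sigma>' Normal \<Longrightarrow>
    vf_exec \<sigma>' (StmtWhile e i s) \<sigma>'' out \<Longrightarrow>
    vf_exec \<sigma> (StmtWhile e i s) \<sigma>'' out"
| vf_while_false: "evalB e \<sigma> = Some False \<Longrightarrow> vf_exec \<sigma> (StmtWhile e i s) \<sigma> Normal"
| vf_block: "vf_exec \<sigma> s \<sigma>' out \<Longrightarrow> vf_exec \<sigma> (StmtBlock s) \<sigma>' out"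

coinductive vf_diverges :: "vf_store \<Rightarrow> vf_stmt \<Rightarrow> bool" where
  vfd_seq1: "vf_diverges \<sigma> s1 \<Longrightarrow> vf_diverges \<sigma> (StmtSeq s1 s2)"
| vfd_seq2: "vf_exec \<sigma> s1 \<sigma>' Normal \<Longrightarrow> vf_diverges \<sigma>' s2 \<Longrightarrow>
    vf_diverges \<sigma> (StmtSeq s1 s2)"
| vfd_let: "fmlookup \<sigma> x = None \<Longrightarrow> evalZ e \<sigma> = Some z \<Longrightarrow>
    vf_diverges (fmupd x z \<sigma>) s \<Longrightarrow> vf_diverges \<sigma> (StmtLet x e s)"
| vfd_if_true: "evalB e \<sigma> = Some True \<Longrightarrow> vf_diverges \<sigma> s1 \<Longrightarrow>
    vf_diverges \<sigma> (StmtIf e s1 s2)"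
| vfd_if_false: "evalB e \<sigma> = Some False \<Longrightarrow> vf_diverges \<sigma> s2 \<Longrightarrow>
    vf_diverges \<sigma> (StmtIf e s1 s2)"
| vfd_while_body: "evalB e \<sigma> = Some True \<Longrightarrow> vf_diverges \<sigma> s \<Longrightarrow>
    vf_diverges \<sigma> (StmtWhile e i s)"
| vfd_while_step: "evalB e \<sigma> = Some True \<Longrightarrow> vf_exec \<sigma> s \<sigma>' Normal \<Longrightarrow>
    vf_diverges \<sigma>' (StmtWhile e i s) \<Longrightarrow> vf_diverges \<sigma> (StmtWhile e i s)"
| vfd_block: "vf_diverges \<sigma> s \<Longrightarrow> vf_diverges \<sigma> (StmtBlock s)"

text \<open>
  The postcondition is evaluated in the initial store extended with \<open>result\<close>,
  not in the final store \<open>\<sigma>'\<close>.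
\<close>

definition VFcorrect :: "string fset \<Rightarrow> vf_expr \<Rightarrow> vf_stmt \<Rightarrow> vf_expr \<Rightarrow> bool" where
  "VFcorrect X p s q \<longleftrightarrow>
    (\<forall>\<sigma> :: vf_store.
      (\<forall>x z. fmlookup \<sigma> x = Some z \<longrightarrow> in_range z) \<longrightarrow>
      (\<forall>x. x |\<notin>| X \<longrightarrow> fmlookup \<sigma> x = None) \<longrightarrow>
      X |\<subseteq>| fmdom \<sigma> \<longrightarrow>
      translate p
        (\<lambda>P. P \<longrightarrow>
          (\<exists>\<sigma>' v. translate q (\<lambda>Q. vf_exec \<sigma> s \<sigma>' (Return v) \<and> Q) (fmupd ''result'' v \<sigma>))
          \<or> vf_diverges \<sigma> s)
        \<sigma>)"

section \<open>CH2O core C\<close>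

text \<open>
  The fragment of core C over the types \<open>void\<close> and \<open>signed int\<close>; local variables
  are de Bruijn indices.
\<close>

datatype ch_type = TVoid | TSInt

datatype ch_unop = NegOp | ComplOp | NotOp

datatype ch_binop =
    PlusOp | MinusOp | MultOp | DivOp | ModOp
  | ShiftLOp | ShiftROp
  | BitAndOp | BitOrOp | BitXorOp
  | EqOp | LtOp | LeOp

datatype ch_expr =
    EInt int  \<comment> \<open>literal of type \<open>signed int\<close>\<close>
  | EVar nat  \<comment> \<open>the lvalue designating a local variable\<close>
  | ELoad ch_expr
  | EUnop ch_unop ch_expr
  | EBinop ch_binop ch_expr ch_expr
  | EAssign ch_expr ch_expr
  | ECast ch_type ch_expr

datatype ch_stmt =
    SSkip
  | SSeq ch_stmt ch_stmt
  | SLocal ch_type ch_stmt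
  | SDo ch_expr  \<comment> \<open>expression statement\<close>
  | SIf ch_expr ch_stmt ch_stmt
  | SThrow nat
  | SCatch ch_stmt
  | SLoop ch_stmt
  | SRet ch_expr

text \<open>The entry \<open>None\<close> is an uninitialised variable.\<close>

type_synonym ch_store = "int option list"

inductive ch_eval :: "ch_store \<Rightarrow> ch_expr \<Rightarrow> int \<Rightarrow> bool" where
  ch_eval_int: "in_range z \<Longrightarrow> ch_eval \<sigma> (EInt z) z"
| ch_eval_load: "i < length \<sigma> \<Longrightarrow> \<sigma> ! i = Some z \<Longrightarrow> ch_eval \<sigma> (ELoad (EVar i)) z"
| ch_eval_not: "ch_eval \<sigma> e z \<Longrightarrow> ch_eval \<sigma> (EUnop NotOp e) (if z = 0 then 1 else 0)"
| ch_eval_plus: "ch_eval \<sigma> e1 z1 \<Longrightarrow> ch_eval \<sigma> e2 z2 \<Longrightarrow> in_range (z1 + z2) \<Longrightarrow>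
    ch_eval \<sigma> (EBinop PlusOp e1 e2) (z1 + z2)"
| ch_eval_minus: "ch_eval \<sigma> e1 z1 \<Longrightarrow> ch_eval \<sigma> e2 z2 \<Longrightarrow> in_range (z1 - z2) \<Longrightarrow>
    ch_eval \<sigma> (EBinop MinusOp e1 e2) (z1 - z2)"
| ch_eval_div: "ch_eval \<sigma> e1 z1 \<Longrightarrow> ch_eval \<sigma> e2 z2 \<Longrightarrow> z2 \<noteq> 0 \<Longrightarrow> in_range (z1 sdiv z2) \<Longrightarrow>
    ch_eval \<sigma> (EBinop DivOp e1 e2) (z1 sdiv z2)"
| ch_eval_lt: "ch_eval \<sigma> e1 z1 \<Longrightarrow> ch_eval \<sigma> e2 z2 \<Longrightarrow>
    ch_eval \<sigma> (EBinop LtOp e1 e2) (if z1 < z2 then 1 else 0)"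
| ch_eval_le: "ch_eval \<sigma> e1 z1 \<Longrightarrow> ch_eval \<sigma> e2 z2 \<Longrightarrow>
    ch_eval \<sigma> (EBinop LeOp e1 e2) (if z1 \<le> z2 then 1 else 0)"
| ch_eval_eq: "ch_eval \<sigma> e1 z1 \<Longrightarrow> ch_eval \<sigma> e2 z2 \<Longrightarrow>
    ch_eval \<sigma> (EBinop EqOp e1 e2) (if z1 = z2 then 1 else 0)"

datatype ch_outcome = ONormal ch_store | OReturn int | OThrow nat ch_store

definition abnormal :: "ch_outcome \<Rightarrow> bool" where
  "abnormal out \<longleftrightarrow> (\<nexists>\<sigma>. out = ONormal \<sigma>)"

definition nothrown :: "ch_outcome \<Rightarrow> bool" where
  "nothrown out \<longleftrightarrow> (\<nexists>n \<sigma>. out = OThrow n \<sigma>)"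

inductive ch_exec :: "ch_store \<Rightarrow> ch_stmt \<Rightarrow> ch_outcome \<Rightarrow> bool" where
  ch_skip: "ch_exec \<sigma> SSkip (ONormal \<sigma>)"
| ch_seq: "ch_exec \<sigma> s1 (ONormal \<sigma>') \<Longrightarrow> ch_exec \<sigma>' s2 out \<Longrightarrow>
    ch_exec \<sigma> (SSeq s1 s2) out"
| ch_seq_abnormal: "abnormal out \<Longrightarrow> ch_exec \<sigma> s1 out \<Longrightarrow> ch_exec \<sigma> (SSeq s1 s2) out"
| ch_local_normal: "ch_exec (None # \<sigma>) s (ONormal (mv # \<sigma>')) \<Longrightarrow>
    ch_exec \<sigma> (SLocal TSInt s) (ONormal \<sigma>')"
| ch_local_return: "ch_exec (None # \<sigma>) s (OReturn z) \<Longrightarrow>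
    ch_exec \<sigma> (SLocal TSInt s) (OReturn z)"
| ch_local_throw: "ch_exec (None # \<sigma>) s (OThrow n (mv # \<sigma>')) \<Longrightarrow>
    ch_exec \<sigma> (SLocal TSInt s) (OThrow n \<sigma>')"
| ch_assign: "i < length \<sigma> \<Longrightarrow> ch_eval \<sigma> e z \<Longrightarrow>
    ch_exec \<sigma> (SDo (EAssign (EVar i) (ECast TSInt e))) (ONormal (\<sigma>[i := Some z]))"
| ch_assign_void: "i < length \<sigma> \<Longrightarrow> ch_eval \<sigma> e z \<Longrightarrow>
    ch_exec \<sigma> (SDo (ECast TVoid (EAssign (EVar i) e))) (ONormal (\<sigma>[i := Some z]))"
| ch_if: "ch_eval \<sigma> e z \<Longrightarrow> ch_exec \<sigma> (if z = 0 then s2 else s1) out \<Longrightarrow>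
    ch_exec \<sigma> (SIf e s1 s2) out"
| ch_throw: "ch_exec \<sigma> (SThrow n) (OThrow n \<sigma>)"
| ch_catch_0: "ch_exec \<sigma> s (OThrow 0 \<sigma>') \<Longrightarrow> ch_exec \<sigma> (SCatch s) (ONormal \<sigma>')"
| ch_catch_Suc: "ch_exec \<sigma> s (OThrow (n + 1) \<sigma>') \<Longrightarrow> ch_exec \<sigma> (SCatch s) (OThrow n \<sigma>')"
| ch_catch_nothrown: "nothrown out \<Longrightarrow> ch_exec \<sigma> s out \<Longrightarrow> ch_exec \<sigma> (SCatch s) out"
| ch_loop_abnormal: "abnormal out \<Longrightarrow> ch_exec \<sigma> s out \<Longrightarrow> ch_exec \<sigma> (SLoop s) out"
| ch_loop_step: "abnormal out \<Longrightarrow> ch_exec \<sigma> s (ONormal \<sigma>') \<Longrightarrow> ch_exec \<sigma>' (SLoop s) out \<Longrightarrow>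
    ch_exec \<sigma> (SLoop s) out"
| ch_ret: "ch_eval \<sigma> e z \<Longrightarrow> ch_exec \<sigma> (SRet (ECast TSInt e)) (OReturn z)"

coinductive ch_execinf :: "ch_store \<Rightarrow> ch_stmt \<Rightarrow> bool" where
  chd_seq1: "ch_execinf \<sigma> s1 \<Longrightarrow> ch_execinf \<sigma> (SSeq s1 s2)"
| chd_seq2: "ch_exec \<sigma> s1 (ONormal \<sigma>') \<Longrightarrow> ch_execinf \<sigma>' s2 \<Longrightarrow> ch_execinf \<sigma> (SSeq s1 s2)"
| chd_local: "ch_execinf (None # \<sigma>) s \<Longrightarrow> ch_execinf \<sigma> (SLocal TSInt s)"
| chd_if: "ch_eval \<sigma> e z \<Longrightarrow> ch_execinf \<sigma> (if z = 0 then s2 else s1) \<Longrightarrow>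
    ch_execinf \<sigma> (SIf e s1 s2)"
| chd_catch: "ch_execinf \<sigma> s \<Longrightarrow> ch_execinf \<sigma> (SCatch s)"
| chd_loop_body: "ch_execinf \<sigma> s \<Longrightarrow> ch_execinf \<sigma> (SLoop s)"
| chd_loop_step: "ch_exec \<sigma> s (ONormal \<sigma>') \<Longrightarrow> ch_execinf \<sigma>' (SLoop s) \<Longrightarrow>
    ch_execinf \<sigma> (SLoop s)"

definition CHcorrect :: "nat \<Rightarrow> ch_stmt \<Rightarrow> ch_store \<Rightarrow> bool" where
  "CHcorrect n s \<sigma> \<longleftrightarrow>
    (length \<sigma> = n \<and> (\<forall>z. Some z \<in> set \<sigma> \<longrightarrow> in_range z) \<longrightarrow>
      (\<exists>z. ch_exec \<sigma> s (OReturn z)) \<or> ch_execinf \<sigma> s)"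

section \<open>Relation between programs\<close>

inductive expr_rel_int :: "string list \<Rightarrow> vf_expr \<Rightarrow> ch_expr \<Rightarrow> bool" for xs where
  rel_lit: "in_range z \<Longrightarrow> expr_rel_int xs (ExprIntLit z) (EInt z)"
| rel_var: "i < length xs \<Longrightarrow> xs ! i = x \<Longrightarrow> expr_rel_int xs (ExprVar x) (ELoad (EVar i))"
| rel_add: "expr_rel_int xs e1 e1' \<Longrightarrow> expr_rel_int xs e2 e2' \<Longrightarrow>
    expr_rel_int xs (ExprAdd e1 e2) (EBinop PlusOp e1' e2')"
| rel_sub: "expr_rel_int xs e1 e1' \<Longrightarrow> expr_rel_int xs e2 e2' \<Longrightarrow>
    expr_rel_int xs (ExprSub e1 e2) (EBinop MinusOp e1' e2')"
| rel_div: "expr_rel_int xs e1 e1' \<Longrightarrow> expr_rel_int xs e2 e2' \<Longrightarrow>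
    expr_rel_int xs (ExprDiv e1 e2) (EBinop DivOp e1' e2')"

inductive expr_rel_bool :: "string list \<Rightarrow> vf_expr \<Rightarrow> ch_expr \<Rightarrow> bool" for xs where
  rel_lt: "expr_rel_int xs e1 e1' \<Longrightarrow> expr_rel_int xs e2 e2' \<Longrightarrow>
    expr_rel_bool xs (ExprLt e1 e2) (EBinop LtOp e1' e2')"
| rel_le: "expr_rel_int xs e1 e1' \<Longrightarrow> expr_rel_int xs e2 e2' \<Longrightarrow>
    expr_rel_bool xs (ExprLe e1 e2) (EBinop LeOp e1' e2')"
| rel_eq: "expr_rel_int xs e1 e1' \<Longrightarrow> expr_rel_int xs e2 e2' \<Longrightarrow>
    expr_rel_bool xs (ExprEq e1 e2) (EBinop EqOp e1' e2')"
| rel_neq: "expr_rel_int xs e1 e1' \<Longrightarrow> expr_rel_int xs e2 e2' \<Longrightarrow>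
    expr_rel_bool xs (ExprNeq e1 e2) (EUnop NotOp (EBinop EqOp e1' e2'))"
| rel_not: "expr_rel_bool xs e e' \<Longrightarrow> expr_rel_bool xs (ExprNot e) (EUnop NotOp e')"

text \<open>
  A \<open>while\<close> loop becomes an infinite loop left by \<open>throw 0\<close>, caught by the outer
  \<open>catch\<close>.
\<close>

inductive stmt_rel :: "string list \<Rightarrow> vf_stmt \<Rightarrow> ch_stmt \<Rightarrow> bool" where
  rel_skip: "stmt_rel xs StmtSkip SSkip"
| rel_seq: "stmt_rel xs s1 s1' \<Longrightarrow> stmt_rel xs s2 s2' \<Longrightarrow>
    stmt_rel xs (StmtSeq s1 s2) (SSeq s1' s2')"
| rel_let: "x \<notin> set xs \<Longrightarrow> expr_rel_int (x # xs) e e' \<Longrightarrow> stmt_rel (x # xs) s s' \<Longrightarrow>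
    stmt_rel xs (StmtLet x e s)
      (SLocal TSInt (SSeq (SDo (EAssign (EVar 0) (ECast TSInt e'))) s'))"
| rel_assign: "x \<in> set xs \<Longrightarrow> i < length xs \<Longrightarrow> xs ! i = x \<Longrightarrow> expr_rel_int xs e e' \<Longrightarrow>
    stmt_rel xs (StmtExpr (ExprAssign (ExprVar x) e))
      (SDo (ECast TVoid (EAssign (EVar i) e')))"
| rel_if: "expr_rel_bool xs e e' \<Longrightarrow> stmt_rel xs s1 s1' \<Longrightarrow> stmt_rel xs s2 s2' \<Longrightarrow>
    stmt_rel xs (StmtIf e s1 s2) (SIf e' s1' s2')"
| rel_while: "expr_rel_bool xs e e' \<Longrightarrow> stmt_rel xs s s' \<Longrightarrow>
    stmt_rel xs (StmtWhile e i s)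
      (SCatch (SLoop (SSeq (SIf e' SSkip (SThrow 0)) (SCatch s'))))"
| rel_ret: "expr_rel_int xs e e' \<Longrightarrow> stmt_rel xs (StmtRet e) (SRet (ECast TSInt e'))"

end

theory Submission
  imports Defs
begin

text \<open>
  A terminating VeriFast Cx execution is simulated by a core C execution, by induction on the
  former; a diverging one is simulated by coinduction, the simulation relation being extended to
  the intermediate core C statements that the translation of declarations and loops introduces.
  Since core C correctness only asks for the existence of an execution, this forward simulation
  suffices and determinism of core C plays no role.
\<close>

section \<open>Correspondence between stores\<close>

text \<open>An entry \<open>None\<close> stands for a name declared but not yet initialised, which
  the VeriFast store leaves undefined. Distinctness lets an update at one index affect one name
  only; the bound on the domain makes names outside \<open>xs\<close> undefined in
  \<open>\<sigma>\<close>.\<close>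

definition store_rel :: "string list \<Rightarrow> vf_store \<Rightarrow> ch_store \<Rightarrow> bool" where
  "store_rel xs \<sigma> \<tau> \<longleftrightarrow> distinct xs \<and> length \<tau> = length xs \<and>
    (\<forall>i < length xs. \<tau> ! i = fmlookup \<sigma> (xs ! i)) \<and> fset (fmdom \<sigma>) \<subseteq> set xs"

lemma store_rel_update:
  assumes "store_rel xs \<sigma> \<tau>" "i < length xs"
  shows "store_rel xs (fmupd (xs ! i) z \<sigma>) (\<tau>[i := Some z])"
  using assms by (auto simp: store_rel_def nth_list_update nth_eq_iff_index_eq)

text \<open>Describes the moment between declaration and initialisation: \<open>x\<close> is outside
  the domain of \<open>\<sigma>\<close>, so the new entry \<open>None\<close> agrees with the
  unchanged VeriFast store.\<close>

lemma store_rel_declare: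
  assumes "store_rel xs \<sigma> \<tau>" "x \<notin> set xs"
  shows "store_rel (x # xs) \<sigma> (None # \<tau>)"
proof -
  have "fmlookup \<sigma> x = None"
    using assms by (auto simp: store_rel_def fmlookup_dom_iff subset_iff)
  then show ?thesis
    using assms by (auto simp: store_rel_def nth_Cons split: nat.split)
qed

lemma store_rel_initialise:
  assumes "store_rel xs \<sigma> \<tau>" "x \<notin> set xs"
  shows "store_rel (x # xs) (fmupd x z \<sigma>) (Some z # \<tau>)"
  using store_rel_update[OF store_rel_declare[OF assms], of 0 z] by simp

text \<open>Used on leaving the scope of \<open>x\<close>: by distinctness no other entry refers to
  \<open>x\<close>, so deleting it affects only the head.\<close>

lemma store_rel_Cons:
  assumes "store_rel (x # xs) \<sigma> \<tau>"
  obtains mv \<tau>' where "\<tau> = mv # \<tau>'" "store_rel xs (fmdrop x \<sigma>) \<tau>'"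
proof (cases \<tau>)
  case Nil
  then show thesis using assms by (simp add: store_rel_def)
next
  case (Cons mv \<tau>')
  have "\<tau>' ! i = fmlookup (fmdrop x \<sigma>) (xs ! i)" if "i < length xs" for i
  proof -
    have "\<tau> ! Suc i = fmlookup \<sigma> ((x # xs) ! Suc i)" "x \<noteq> xs ! i"
      using assms that unfolding store_rel_def by (fastforce simp: in_set_conv_nth)+
    then show ?thesis using Cons by simp
  qed
  then have "store_rel xs (fmdrop x \<sigma>) \<tau>'"
    using assms Cons by (auto simp: store_rel_def)
  then show thesis using Cons that by blast
qed

section \<open>Evaluation of expressions\<close>

text \<open>Both semantics check the range of arithmetic results. \<open>evalZ\<close> leaves
  literals unchecked, but \<open>expr_rel_int\<close> relates only literals in range.\<close>

lemma evalZ_simulation: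
  assumes "expr_rel_int xs e e'" "store_rel xs \<sigma> \<tau>" "evalZ e \<sigma> = Some z"
  shows "ch_eval \<tau> e' z"
  using assms
  by (induction arbitrary: z rule: expr_rel_int.induct)
    (auto simp: store_rel_def check_range_def intro!: ch_eval.intros
      split: option.splits if_splits)

text \<open>Core C represents truth values by 1 and 0, which \<open>NotOp\<close> exchanges;
  disequality is evaluated as a negated equality.\<close>

lemma evalB_simulation:
  assumes "expr_rel_bool xs e e'" "store_rel xs \<sigma> \<tau>" "evalB e \<sigma> = Some b"
  shows "ch_eval \<tau> e' (if b then 1 else 0)"
  using assms
proof (induction arbitrary: b rule: expr_rel_bool.induct)
  case (rel_neq e1 e1' e2 e2')
  then obtain z1 z2 where z: "evalZ e1 \<sigma> = Some z1" "evalZ e2 \<sigma> = Some z2" "b = (z1 \<noteq> z2)"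
    by (auto split: option.splits)
  have "ch_eval \<tau> (EBinop EqOp e1' e2') (if z1 = z2 then 1 else 0)"
    using rel_neq z by (intro ch_eval_eq evalZ_simulation)
  from ch_eval_not[OF this] show ?case using z by (auto split: if_splits)
next
  case (rel_not e e')
  then obtain b' where b: "evalB e \<sigma> = Some b'" "b = (\<not> b')"
    by (auto split: option.splits)
  from ch_eval_not[OF rel_not.IH[OF rel_not.prems(1) b(1)]] show ?case
    using b by (auto split: if_splits)
next
  case (rel_lt e1 e1' e2 e2')
  then obtain z1 z2 where z: "evalZ e1 \<sigma> = Some z1" "evalZ e2 \<sigma> = Some z2" "b = (z1 < z2)"
    by (auto split: option.splits)
  have "ch_eval \<tau> (EBinop LtOp e1' e2') (if z1 < z2 then 1 else 0)"
    using rel_lt z by (intro ch_eval_lt evalZ_simulation)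
  then show ?case using z by simp
next
  case (rel_le e1 e1' e2 e2')
  then obtain z1 z2 where z: "evalZ e1 \<sigma> = Some z1" "evalZ e2 \<sigma> = Some z2" "b = (z1 \<le> z2)"
    by (auto split: option.splits)
  have "ch_eval \<tau> (EBinop LeOp e1' e2') (if z1 \<le> z2 then 1 else 0)"
    using rel_le z by (intro ch_eval_le evalZ_simulation)
  then show ?case using z by simp
next
  case (rel_eq e1 e1' e2 e2')
  then obtain z1 z2 where z: "evalZ e1 \<sigma> = Some z1" "evalZ e2 \<sigma> = Some z2" "b = (z1 = z2)"
    by (auto split: option.splits)
  have "ch_eval \<tau> (EBinop EqOp e1' e2') (if z1 = z2 then 1 else 0)"
    using rel_eq z by (intro ch_eval_eq evalZ_simulation)
  then show ?case using z by simp
qed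

section \<open>Inversion rules and the core C encoding of loops\<close>

inductive_cases stmt_rel_SkipE: "stmt_rel xs StmtSkip t"
inductive_cases stmt_rel_SeqE: "stmt_rel xs (StmtSeq s1 s2) t"
inductive_cases stmt_rel_LetE: "stmt_rel xs (StmtLet x e s) t"
inductive_cases stmt_rel_AssignE: "stmt_rel xs (StmtExpr e) t"
inductive_cases stmt_rel_IfE: "stmt_rel xs (StmtIf e s1 s2) t"
inductive_cases stmt_rel_WhileE: "stmt_rel xs (StmtWhile e i s) t"
inductive_cases stmt_rel_RetE: "stmt_rel xs (StmtRet e) t"
inductive_cases stmt_rel_BlockE: "stmt_rel xs (StmtBlock s) t"

inductive_cases ch_exec_CatchE: "ch_exec \<tau> (SCatch s) out"
inductive_cases ch_exec_LoopE: "ch_exec \<tau> (SLoop s) out"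

lemma abnormal_simps [simp]:
  "\<not> abnormal (ONormal \<tau>)" "abnormal (OReturn z)" "abnormal (OThrow n \<tau>)"
  by (auto simp: abnormal_def)

lemma nothrown_simps [simp]:
  "nothrown (ONormal \<tau>)" "nothrown (OReturn z)" "\<not> nothrown (OThrow n \<tau>)"
  by (auto simp: nothrown_def)

abbreviation while_body :: "ch_expr \<Rightarrow> ch_stmt \<Rightarrow> ch_stmt" where
  "while_body e s \<equiv> SSeq (SIf e SSkip (SThrow 0)) (SCatch s)"

lemma ch_exec_guard_true:
  assumes "ch_eval \<tau> e 1"
  shows "ch_exec \<tau> (SIf e SSkip s) (ONormal \<tau>)"
  by (rule ch_if[OF assms]) (simp add: ch_skip)

lemma ch_exec_while_body:
  assumes "ch_eval \<tau> e 1" "ch_exec \<tau> s out" "nothrown out"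
  shows "ch_exec \<tau> (while_body e s) out"
  using assms by (blast intro: ch_seq ch_exec_guard_true ch_catch_nothrown)

text \<open>The guard throws 0 before the inner catch is entered, the loop stops on this abnormal
  outcome, and the outer catch turns it into normal termination in the same store.\<close>

lemma ch_exec_while_false:
  assumes "ch_eval \<tau> e 0"
  shows "ch_exec \<tau> (SCatch (SLoop (while_body e s))) (ONormal \<tau>)"
proof -
  have "ch_exec \<tau> (SIf e SSkip (SThrow 0)) (OThrow 0 \<tau>)"
    by (rule ch_if[OF assms]) (simp add: ch_throw)
  then show ?thesis
    by (intro ch_catch_0 ch_loop_abnormal ch_seq_abnormal) simp_all
qed

text \<open>The simulation of the remaining iterations concerns the loop together with its catch, so
  the catch is opened, one iteration put in front, and the catch closed again.\<close>

lemma ch_exec_catch_loop_step: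
  assumes "ch_exec \<tau> s (ONormal \<tau>')" "ch_exec \<tau>' (SCatch (SLoop s)) out"
  shows "ch_exec \<tau> (SCatch (SLoop s)) out"
proof -
  \<comment> \<open>By inversion every outcome of a loop is abnormal, which is the side condition of
    \<open>ch_loop_step\<close>.\<close>
  have step: "ch_exec \<tau> (SLoop s) out'" if "ch_exec \<tau>' (SLoop s) out'" for out'
    using that assms(1) by (metis ch_exec_LoopE ch_loop_step)
  from assms(2) show ?thesis
    by (rule ch_exec_CatchE)
      (auto intro: ch_catch_0 ch_catch_nothrown step
        ch_catch_Suc[unfolded Suc_eq_plus1[symmetric]])
qed

section \<open>Simulation of terminating executions\<close>

text \<open>VeriFast outcomes contain no throw, and \<open>OReturn\<close> carries no store, so
  stores are compared only after normal termination.\<close>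

definition outcome_sim ::
    "string list \<Rightarrow> ch_store \<Rightarrow> ch_stmt \<Rightarrow> vf_store \<Rightarrow> vf_outcome \<Rightarrow> bool" where
  "outcome_sim xs \<tau> t \<sigma>' out \<longleftrightarrow> (case out of
      Normal \<Rightarrow> \<exists>\<tau>'. ch_exec \<tau> t (ONormal \<tau>') \<and> store_rel xs \<sigma>' \<tau>'
    | Return z \<Rightarrow> ch_exec \<tau> t (OReturn z))"

lemma outcome_sim_Normal [simp]:
  "outcome_sim xs \<tau> t \<sigma>' Normal \<longleftrightarrow> (\<exists>\<tau>'. ch_exec \<tau> t (ONormal \<tau>') \<and> store_rel xs \<sigma>' \<tau>')"
  by (simp add: outcome_sim_def)

lemma outcome_sim_Return [simp]:
  "outcome_sim xs \<tau> t \<sigma>' (Return z) \<longleftrightarrow> ch_exec \<tau> t (OReturn z)"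
  by (simp add: outcome_sim_def)

text \<open>Lifts the simulation of a substatement, or of the rest of an execution, to the whole.
  Only normal and return outcomes occur in \<open>outcome_sim\<close>, hence
  \<open>nothrown\<close>.\<close>

lemma outcome_sim_mono:
  assumes "outcome_sim xs \<tau> t \<sigma>' out"
    and "\<And>out'. nothrown out' \<Longrightarrow> ch_exec \<tau> t out' \<Longrightarrow> ch_exec \<tau>\<^sub>1 t\<^sub>1 out'"
  shows "outcome_sim xs \<tau>\<^sub>1 t\<^sub>1 \<sigma>' out"
  using assms(1) by (cases out)
    (auto intro: assms(2)[OF nothrown_simps(1)] assms(2)[OF nothrown_simps(2)])

lemma ch_exec_initialise:
  assumes "ch_eval (None # \<tau>) e z"
  shows "ch_exec (None # \<tau>) (SDo (EAssign (EVar 0) (ECast TSInt e))) (ONormal (Some z # \<tau>))"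
  using ch_assign[of 0 "None # \<tau>" e z] assms by simp

lemma vf_exec_simulation:
  assumes "vf_exec \<sigma> s \<sigma>' out" "stmt_rel xs s t" "store_rel xs \<sigma> \<tau>"
  shows "outcome_sim xs \<tau> t \<sigma>' out"
  using assms
proof (induction arbitrary: xs t \<tau> rule: vf_exec.induct)
  case (vf_skip \<sigma>)
  then show ?case by (auto elim!: stmt_rel_SkipE intro: ch_skip)
next
  case (vf_seq \<sigma> s1 \<sigma>' s2 \<sigma>'' out)
  from vf_seq.prems(1) obtain t1 t2
    where t: "t = SSeq t1 t2" "stmt_rel xs s1 t1" "stmt_rel xs s2 t2"
    by (rule stmt_rel_SeqE)
  from vf_seq.IH(1)[OF t(2) vf_seq.prems(2)] obtain \<tau>'
    where \<tau>': "ch_exec \<tau> t1 (ONormal \<tau>')" "store_rel xs \<sigma>' \<tau>'"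
    by auto
  from vf_seq.IH(2)[OF t(3) \<tau>'(2)] show ?case
    unfolding t(1) by (rule outcome_sim_mono) (blast intro: ch_seq \<tau>')
next
  case (vf_seq_abnormal \<sigma> s1 \<sigma>' out s2)
  from vf_seq_abnormal.prems(1) obtain t1 t2 where t: "t = SSeq t1 t2" "stmt_rel xs s1 t1"
    by (rule stmt_rel_SeqE)
  from vf_seq_abnormal.IH[OF t(2) vf_seq_abnormal.prems(2)] vf_seq_abnormal.hyps(2) show ?case
    using t(1) by (cases out) (auto intro: ch_seq_abnormal)
next
  case (vf_let \<sigma> x e z s \<sigma>' out)
  from vf_let.prems(1) obtain e' s' where t:
      "t = SLocal TSInt (SSeq (SDo (EAssign (EVar 0) (ECast TSInt e'))) s')"
      "x \<notin> set xs" "expr_rel_int (x # xs) e e'" "stmt_rel (x # xs) s s'"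
    by (rule stmt_rel_LetE)
  \<comment> \<open>Core C evaluates the initialiser with \<open>x\<close> declared but
    uninitialised, VeriFast in \<open>\<sigma>\<close>, where \<open>x\<close> is undefined.\<close>
  have "ch_eval (None # \<tau>) e' z"
    using evalZ_simulation t(3) store_rel_declare[OF vf_let.prems(2) t(2)] vf_let.hyps(2) by blast
  note init = ch_seq[OF ch_exec_initialise[OF this]]
  have sim: "outcome_sim (x # xs) (Some z # \<tau>) s' \<sigma>' out"
    using vf_let.IH t(4) store_rel_initialise[OF vf_let.prems(2) t(2)] by blast
  show ?case
  proof (cases out)
    case Normal
    with sim obtain \<tau>'' where \<tau>'':
        "ch_exec (Some z # \<tau>) s' (ONormal \<tau>'')" "store_rel (x # xs) \<sigma>' \<tau>''"
      by auto
    from \<tau>''(2) obtain mv \<tau>' where "\<tau>'' = mv # \<tau>'" "store_rel xs (fmdrop x \<sigma>') \<tau>'"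
      by (rule store_rel_Cons)
    with \<tau>''(1) Normal t(1) show ?thesis
      by (auto intro!: exI[of _ \<tau>'] ch_local_normal init)
  next
    case (Return v)
    with sim t(1) show ?thesis by (auto intro: ch_local_return init)
  qed
next
  case (vf_assign \<sigma> x e z)
  from vf_assign.prems(1) obtain i e' where t:
      "t = SDo (ECast TVoid (EAssign (EVar i) e'))" "i < length xs" "xs ! i = x"
      "expr_rel_int xs e e'"
    by (auto elim!: stmt_rel_AssignE)
  have "ch_eval \<tau> e' z"
    using evalZ_simulation t(4) vf_assign by blast
  moreover have "i < length \<tau>"
    using t(2) vf_assign.prems(2) by (simp add: store_rel_def)
  ultimately show ?case
    using t store_rel_update[OF vf_assign.prems(2) t(2), of z] by (auto intro: ch_assign_void)
next
  case (vf_if_true e \<sigma> s1 \<sigma>' out s2)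
  from vf_if_true.prems(1) obtain e' t1 t2 where t:
      "t = SIf e' t1 t2" "expr_rel_bool xs e e'" "stmt_rel xs s1 t1"
    by (rule stmt_rel_IfE)
  from evalB_simulation[OF t(2) vf_if_true.prems(2) vf_if_true.hyps(1)]
  have "ch_eval \<tau> e' 1" by simp
  note branch = ch_if[OF this]
  from vf_if_true.IH[OF t(3) vf_if_true.prems(2)] show ?case
    unfolding t(1) by (rule outcome_sim_mono) (auto intro: branch)
next
  case (vf_if_false e \<sigma> s2 \<sigma>' out s1)
  from vf_if_false.prems(1) obtain e' t1 t2 where t:
      "t = SIf e' t1 t2" "expr_rel_bool xs e e'" "stmt_rel xs s2 t2"
    by (rule stmt_rel_IfE)
  from evalB_simulation[OF t(2) vf_if_false.prems(2) vf_if_false.hyps(1)]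
  have "ch_eval \<tau> e' 0" by simp
  note branch = ch_if[OF this]
  from vf_if_false.IH[OF t(3) vf_if_false.prems(2)] show ?case
    unfolding t(1) by (rule outcome_sim_mono) (auto intro: branch)
next
  case (vf_ret e \<sigma> z)
  then show ?case by (auto elim!: stmt_rel_RetE intro: ch_ret evalZ_simulation)
next
  case (vf_while_abnormal e \<sigma> s \<sigma>' out i)
  from vf_while_abnormal.prems(1) obtain e' s' where t:
      "t = SCatch (SLoop (while_body e' s'))" "expr_rel_bool xs e e'" "stmt_rel xs s s'"
    by (rule stmt_rel_WhileE)
  \<comment> \<open>The only abnormal VeriFast outcome is a return, which ends the loop and passes
    through both catches.\<close>
  obtain v where out: "out = Return v"
    using vf_while_abnormal.hyps(3) by (cases out) auto
  from evalB_simulation[OF t(2) vf_while_abnormal.prems(2) vf_while_abnormal.hyps(1)]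
  have "ch_eval \<tau> e' 1" by simp
  moreover have "ch_exec \<tau> s' (OReturn v)"
    using vf_while_abnormal.IH[OF t(3) vf_while_abnormal.prems(2)] out by simp
  ultimately have "ch_exec \<tau> (while_body e' s') (OReturn v)"
    by (rule ch_exec_while_body) simp
  then show ?case
    using out t(1) by (simp add: ch_catch_nothrown ch_loop_abnormal)
next
  case (vf_while_step e \<sigma> s \<sigma>' i \<sigma>'' out)
  from vf_while_step.prems(1) obtain e' s' where t:
      "t = SCatch (SLoop (while_body e' s'))" "expr_rel_bool xs e e'" "stmt_rel xs s s'"
    by (rule stmt_rel_WhileE)
  from evalB_simulation[OF t(2) vf_while_step.prems(2) vf_while_step.hyps(1)]
  have e': "ch_eval \<tau> e' 1" by simp
  from vf_while_step.IH(1)[OF t(3) vf_while_step.prems(2)] obtain \<tau>'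
    where \<tau>': "ch_exec \<tau> s' (ONormal \<tau>')" "store_rel xs \<sigma>' \<tau>'"
    by auto
  have "ch_exec \<tau> (while_body e' s') (ONormal \<tau>')"
    using ch_exec_while_body[OF e' \<tau>'(1)] by simp
  note step = ch_exec_catch_loop_step[OF this]
  from vf_while_step.IH(2)[OF vf_while_step.prems(1) \<tau>'(2)] show ?case
    unfolding t(1) by (rule outcome_sim_mono) (rule step)
next
  case (vf_while_false e \<sigma> i s)
  from vf_while_false.prems(1) obtain e' s' where t:
      "t = SCatch (SLoop (while_body e' s'))" "expr_rel_bool xs e e'"
    by (rule stmt_rel_WhileE)
  from evalB_simulation[OF t(2) vf_while_false.prems(2) vf_while_false.hyps]
  have "ch_eval \<tau> e' 0" by simp
  then show ?case
    using t(1) vf_while_false.prems(2) ch_exec_while_false by auto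
next
  case (vf_block \<sigma> s \<sigma>' out)
  \<comment> \<open>\<open>stmt_rel\<close> has no rule for \<open>StmtBlock\<close>, so this case
    is contradictory.\<close>
  then show ?case by (blast elim: stmt_rel_BlockE)
qed

section \<open>Simulation of diverging executions\<close>

text \<open>
  \<open>div_loop\<close> is needed because the loop inside the translation of a \<open>while\<close> statement
  is not itself the translation of a statement.
\<close>

inductive div_rel :: "ch_store \<Rightarrow> ch_stmt \<Rightarrow> bool" where
  div_stmt: "stmt_rel xs s t \<Longrightarrow> store_rel xs \<sigma> \<tau> \<Longrightarrow> vf_diverges \<sigma> s \<Longrightarrow> div_rel \<tau> t"
| div_loop: "stmt_rel xs (StmtWhile e i s) (SCatch (SLoop t)) \<Longrightarrow> store_rel xs \<sigma> \<tau> \<Longrightarrow>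
    vf_diverges \<sigma> (StmtWhile e i s) \<Longrightarrow> div_rel \<tau> (SLoop t)"
| div_seq: "ch_exec \<tau> t1 (ONormal \<tau>') \<Longrightarrow> div_rel \<tau>' t2 \<Longrightarrow> div_rel \<tau> (SSeq t1 t2)"
| div_catch: "div_rel \<tau> t \<Longrightarrow> div_rel \<tau> (SCatch t)"

text \<open>The monotone functional whose greatest fixed point is \<open>ch_execinf\<close>, written
  as a case distinction on the statement.\<close>

definition execinf_step :: "(ch_store \<Rightarrow> ch_stmt \<Rightarrow> bool) \<Rightarrow> ch_store \<Rightarrow> ch_stmt \<Rightarrow> bool" where
  "execinf_step R \<tau> t \<longleftrightarrow> (case t of
      SSeq t1 t2 \<Rightarrow> R \<tau> t1 \<or> (\<exists>\<tau>'. ch_exec \<tau> t1 (ONormal \<tau>') \<and> R \<tau>' t2)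
    | SLocal T t' \<Rightarrow> T = TSInt \<and> R (None # \<tau>) t'
    | SIf e t1 t2 \<Rightarrow> \<exists>z. ch_eval \<tau> e z \<and> R \<tau> (if z = 0 then t2 else t1)
    | SCatch t' \<Rightarrow> R \<tau> t'
    | SLoop t' \<Rightarrow> R \<tau> t' \<or> (\<exists>\<tau>'. ch_exec \<tau> t' (ONormal \<tau>') \<and> R \<tau>' (SLoop t'))
    | _ \<Rightarrow> False)"

text \<open>The form of \<open>t\<close> selects the rules of \<open>ch_execinf\<close> that can
  apply, and \<open>execinf_step\<close> supplies the premises of one of them with \<open>R\<close>
  for the recursive occurrence, so coinduction applies.\<close>

lemma ch_execinf_coinduct_step:
  assumes "R \<tau> t" and step: "\<And>\<tau> t. R \<tau> t \<Longrightarrow> execinf_step R \<tau> t"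
  shows "ch_execinf \<tau> t"
  using assms(1)
proof (coinduction arbitrary: \<tau> t)
  case (ch_execinf \<tau> t)
  note step = step[OF this, unfolded execinf_step_def]
  show ?case
  proof (cases t)
    case (SIf e t1 t2)
    with step obtain z where "ch_eval \<tau> e z" "R \<tau> (if z = 0 then t2 else t1)"
      by auto
    with SIf show ?thesis by (auto intro!: exI[of _ z])
  qed (use step in auto)
qed

text \<open>In each possible case of the VeriFast divergence one constructor of \<open>t\<close> is
  peeled off, and what remains is again in \<open>div_rel\<close>, possibly by an auxiliary
  rule.\<close>

lemma div_rel_stmt_step:
  assumes "vf_diverges \<sigma> s" "stmt_rel xs s t" "store_rel xs \<sigma> \<tau>"
  shows "execinf_step div_rel \<tau> t"
  using assms(1)
proof cases
  case (vfd_seq1 s1 s2)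
  then show ?thesis
    using assms by (auto simp: execinf_step_def elim!: stmt_rel_SeqE intro: div_stmt)
next
  case (vfd_seq2 s1 \<sigma>' s2)
  from assms(2) obtain t1 t2
    where t: "t = SSeq t1 t2" "stmt_rel xs s1 t1" "stmt_rel xs s2 t2"
    unfolding vfd_seq2(1) by (rule stmt_rel_SeqE)
  from vf_exec_simulation[OF vfd_seq2(2) t(2) assms(3)] obtain \<tau>'
    where "ch_exec \<tau> t1 (ONormal \<tau>')" "store_rel xs \<sigma>' \<tau>'"
    by auto
  then show ?thesis
    using t vfd_seq2(3) by (auto simp: execinf_step_def intro: div_stmt)
next
  case (vfd_let x e z s0)
  from assms(2) obtain e' s' where t:
      "t = SLocal TSInt (SSeq (SDo (EAssign (EVar 0) (ECast TSInt e'))) s')"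
      "x \<notin> set xs" "expr_rel_int (x # xs) e e'" "stmt_rel (x # xs) s0 s'"
    unfolding vfd_let(1) by (rule stmt_rel_LetE)
  have "ch_eval (None # \<tau>) e' z"
    using evalZ_simulation t(3) store_rel_declare[OF assms(3) t(2)] vfd_let(3) by blast
  moreover have "div_rel (Some z # \<tau>) s'"
    using t(4) store_rel_initialise[OF assms(3) t(2)] vfd_let(4) by (rule div_stmt)
  \<comment> \<open>Below \<open>SLocal\<close> stands a sequence that is not itself a translation;
    \<open>div_seq\<close> admits it, since the initialisation terminates normally.\<close>
  ultimately show ?thesis
    using t(1) by (auto simp: execinf_step_def intro: div_seq ch_exec_initialise)
next
  case (vfd_if_true e s1 s2)
  from assms(2) obtain e' t1 t2 where t:
      "t = SIf e' t1 t2" "expr_rel_bool xs e e'" "stmt_rel xs s1 t1"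
    unfolding vfd_if_true(1) by (rule stmt_rel_IfE)
  then show ?thesis
    using evalB_simulation[OF t(2) assms(3) vfd_if_true(2)] div_stmt[OF t(3) assms(3) vfd_if_true(3)]
    by (auto simp: execinf_step_def intro!: exI[of _ 1])
next
  case (vfd_if_false e s2 s1)
  from assms(2) obtain e' t1 t2 where t:
      "t = SIf e' t1 t2" "expr_rel_bool xs e e'" "stmt_rel xs s2 t2"
    unfolding vfd_if_false(1) by (rule stmt_rel_IfE)
  then show ?thesis
    using evalB_simulation[OF t(2) assms(3) vfd_if_false(2)]
      div_stmt[OF t(3) assms(3) vfd_if_false(3)]
    by (auto simp: execinf_step_def intro!: exI[of _ 0])
next
  case (vfd_while_body e s0 i)
  from assms(2) obtain t' where t: "t = SCatch (SLoop t')"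
    unfolding vfd_while_body(1) by (rule stmt_rel_WhileE)
  \<comment> \<open>Only the outer catch is removed here; whether the body or a later iteration
    diverges is decided when the loop itself is unfolded.\<close>
  from assms(2,3,1) have "div_rel \<tau> (SLoop t')"
    unfolding t vfd_while_body(1) by (rule div_loop)
  then show ?thesis by (simp add: t execinf_step_def)
next
  case (vfd_while_step e s0 \<sigma>' i)
  from assms(2) obtain t' where t: "t = SCatch (SLoop t')"
    unfolding vfd_while_step(1) by (rule stmt_rel_WhileE)
  from assms(2,3,1) have "div_rel \<tau> (SLoop t')"
    unfolding t vfd_while_step(1) by (rule div_loop)
  then show ?thesis by (simp add: t execinf_step_def)
next
  case (vfd_block s0)
  then show ?thesis using assms by (blast elim: stmt_rel_BlockE)
qed

text \<open>If the body diverges, so does the current iteration, whose guard terminates normally;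
  otherwise the iteration terminates and the same loop diverges from the next store.\<close>

lemma div_rel_loop_step:
  assumes "vf_diverges \<sigma> (StmtWhile e i s)" "stmt_rel xs (StmtWhile e i s) (SCatch (SLoop t))"
    and "store_rel xs \<sigma> \<tau>"
  shows "execinf_step div_rel \<tau> (SLoop t)"
proof -
  from assms(2) obtain e' s' where t:
      "t = while_body e' s'" "expr_rel_bool xs e e'" "stmt_rel xs s s'"
    by (auto elim!: stmt_rel_WhileE)
  have e': "ch_eval \<tau> e' 1" if "evalB e \<sigma> = Some True"
    using evalB_simulation[OF t(2) assms(3) that] by simp
  from assms(1) show ?thesis
  proof cases
    case vfd_while_body
    have "div_rel \<tau> t"
      unfolding t(1) using ch_exec_guard_true[OF e'[OF vfd_while_body(1)]]
      by (rule div_seq) (intro div_catch div_stmt[OF t(3) assms(3) vfd_while_body(2)])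
    then show ?thesis by (simp add: execinf_step_def)
  next
    case (vfd_while_step \<sigma>')
    from vf_exec_simulation[OF vfd_while_step(2) t(3) assms(3)] obtain \<tau>'
      where \<tau>': "ch_exec \<tau> s' (ONormal \<tau>')" "store_rel xs \<sigma>' \<tau>'"
      by auto
    have "ch_exec \<tau> t (ONormal \<tau>')"
      unfolding t(1) using e'[OF vfd_while_step(1)] \<tau>'(1) by (rule ch_exec_while_body) simp
    \<comment> \<open>\<open>div_loop\<close> refers to the full while statement, so
      \<open>assms(2)\<close> serves again at the next store.\<close>
    moreover have "div_rel \<tau>' (SLoop t)"
      using assms(2) \<tau>'(2) vfd_while_step(3) by (rule div_loop)
    ultimately show ?thesis by (auto simp: execinf_step_def)
  qed
qed

lemma div_rel_step:
  assumes "div_rel \<tau> t"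
  shows "execinf_step div_rel \<tau> t"
  using assms
proof cases
  case div_stmt
  then show ?thesis by (blast intro: div_rel_stmt_step)
next
  case div_loop
  then show ?thesis by (blast intro: div_rel_loop_step)
qed (auto simp: execinf_step_def)

lemma vf_diverges_simulation:
  assumes "vf_diverges \<sigma> s" "stmt_rel xs s t" "store_rel xs \<sigma> \<tau>"
  shows "ch_execinf \<tau> t"
  using div_stmt[OF assms(2,3,1)] div_rel_step by (rule ch_execinf_coinduct_step)

section \<open>Initial stores and function correctness\<close>

lemma store_rel_of_values:
  assumes "distinct xs" "length zs = length xs"
  shows "store_rel xs (fmap_of_list (zip xs zs)) (map Some zs)"
  using assms by (auto simp: store_rel_def fmlookup_of_list map_of_zip_nth
      fmdom_fmap_of_list fset_of_list.rep_eq)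

theorem theorem4p9:
  fixes xs :: "string list" and xs_v :: "string fset"
    and s_v :: vf_stmt and q_v :: vf_expr and s_h :: ch_stmt
  assumes "xs \<in> permutations_of_set (fset xs_v)"
    and "stmt_rel xs s_v s_h"
    and "VFcorrect xs_v ExprTrue s_v q_v"
  shows "\<forall>\<sigma>_h :: ch_store. (\<forall>mv \<in> set \<sigma>_h. \<exists>z. mv = Some z) \<longrightarrow> CHcorrect (length xs) s_h \<sigma>_h"
proof (intro allI impI)
  fix \<sigma>_h :: ch_store
  assume "\<forall>mv \<in> set \<sigma>_h. \<exists>z. mv = Some z"
  then obtain zs where zs: "\<sigma>_h = map Some zs"
    by (metis ex_map_conv)
  have xs: "distinct xs" "set xs = fset xs_v"
    using assms(1) by (auto simp: permutations_of_set_def)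
  show "CHcorrect (length xs) s_h \<sigma>_h"
    unfolding CHcorrect_def
  proof (intro impI, elim conjE)
    assume len: "length \<sigma>_h = length xs" and range: "\<forall>z. Some z \<in> set \<sigma>_h \<longrightarrow> in_range z"
    define \<sigma> where "\<sigma> = fmap_of_list (zip xs zs)"
    have rel: "store_rel xs \<sigma> \<sigma>_h"
      using store_rel_of_values xs(1) len zs by (simp add: \<sigma>_def)
    \<comment> \<open>\<open>VFcorrect\<close> speaks of stores defined exactly on
      \<open>xs_v\<close>, the set of names in \<open>xs\<close>.\<close>
    have dom: "fmdom \<sigma> = xs_v"
      using xs(2) len zs
      by (simp add: \<sigma>_def fmdom_fmap_of_list fset_of_list.rep_eq flip: fset_inject)
    have "in_range z" if "fmlookup \<sigma> x = Some z" for x z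
    proof -
      from that have "z \<in> set zs"
        by (auto simp: \<sigma>_def fmlookup_of_list dest!: map_of_SomeD dest: set_zip_rightD)
      then show ?thesis using range zs by auto
    qed
    moreover have "fmlookup \<sigma> x = None" if "x |\<notin>| xs_v" for x
      using that dom by (simp add: fmdom_notD)
    ultimately have "translate ExprTrue
        (\<lambda>P. P \<longrightarrow>
          (\<exists>\<sigma>' v. translate q_v (\<lambda>Q. vf_exec \<sigma> s_v \<sigma>' (Return v) \<and> Q) (fmupd ''result'' v \<sigma>))
          \<or> vf_diverges \<sigma> s_v) \<sigma>"
      using assms(3) dom unfolding VFcorrect_def by blast
    \<comment> \<open>\<open>ExprTrue\<close> evaluates to \<open>True\<close>, which discharges the
      precondition; the terminating execution is read off from its conjunction with the
      postcondition.\<close>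
    then consider \<sigma>' v where "vf_exec \<sigma> s_v \<sigma>' (Return v)" | "vf_diverges \<sigma> s_v"
      by (auto simp: translate_def split: option.splits)
    then show "(\<exists>z. ch_exec \<sigma>_h s_h (OReturn z)) \<or> ch_execinf \<sigma>_h s_h"
    proof cases
      case 1
      then show ?thesis using vf_exec_simulation[OF _ assms(2) rel] by fastforce
    next
      case 2
      then show ?thesis using vf_diverges_simulation assms(2) rel by blast
    qed
  qed
qed

end
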